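(* Let $0<\lambda<1$ and let $W$ be a positive integer-valued random variable with $\mathbb{E}[W]=(1-\lambda)^{-1}$. Let $W^\star$ denote a random variable having the size-biased distribution of $W$, let $I$ be a Bernoulli random variable with $\mathbb{P}(I=1)=\lambda$, let $Z\sim\mathrm{Borel}(\lambda)$, and suppose that $W$, $W^\star$, $I$ and $Z$ are independent. Then $$d_{TV}(\mathcal{L}(W),\mathrm{Borel}(\lambda))\leq \frac{1}{(1-\lambda)^2}\, d_{TV}\Big(\mathcal{L}(W^\star),\,\mathcal{L}\big((1-I)W+I(Z+W^\star)\big)\Big).$$
   Context: $\mathbb{N}=\{1,2,\ldots\}$. For $0<\lambda<1$, $\mathrm{Borel}(\lambda)$ is the distribution on $\mathbb{N}$ with mass function $\mathbb{P}(Z=j)=\frac{e^{-\lambda j}(\lambda j)^{j-1}}{j!}$, $j\in\mathbb{N}$; its mean is $(1-\lambda)^{-1}$. For a positive integer-valued random variable $W$ with finite mean, the size-biased version $W^\star$ has the distribution $\mathbb{P}(W^\star=j)=\frac{j\,\mathbb{P}(W=j)}{\mathbb{E}[W]}$, $j\in\mathbb{N}$. $\mathcal{L}(X)$ denotes the law of $X$. For random variables $X,Y$ with values in $\mathbb{N}$, the total variation distance is $d_{TV}(\mathcal{L}(X),\mathcal{L}(Y))=\sup_{A\subseteq\mathbb{N}}|\mathbb{P}(X\in A)-\mathbb{P}(Y\in A)|$. *)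

theory Defs
  imports "HOL-Probability.Probability"
begin

text \<open>
  The distributions considered here live on the positive integers. They are represented as measures on
  all of \<^typ>\<open>nat\<close> (with the discrete sigma-algebra) that give no mass to 0.
\<close>

abbreviation law :: "'a measure \<Rightarrow> ('a \<Rightarrow> nat) \<Rightarrow> nat measure" where
  "law M X \<equiv> distr M (count_space UNIV) X"

text \<open>The case \<open>j = 0\<close> is separate because the formula would evaluate to 1 there.\<close>

definition borel_mass :: "real \<Rightarrow> nat \<Rightarrow> real" where
  "borel_mass lam j =
     (if j = 0 then 0 else exp (- lam * real j) * (lam * real j) ^ (j - 1) / fact j)"

definition borel_dist :: "real \<Rightarrow> nat measure" where
  "borel_dist lam = density (count_space UNIV) (\<lambda>j. ennreal (borel_mass lam j))"

definition size_biased :: "nat measure \<Rightarrow> nat measure" where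
  "size_biased \<mu> =
     density (count_space UNIV)
       (\<lambda>j. ennreal (real j * measure \<mu> {j} / (\<integral>x. real x \<partial>\<mu>)))"

text \<open>Meaningful for two probability measures on the same sigma-algebra.\<close>

definition tv_dist :: "'a measure \<Rightarrow> 'a measure \<Rightarrow> real" where
  "tv_dist \<mu> \<nu> = (SUP A\<in>sets \<mu>. \<bar>measure \<mu> A - measure \<nu> A\<bar>)"

end

theory Submission
  imports Defs
begin

text \<open>
  Write \<open>p\<close> and \<open>b\<close> for the mass functions of \<open>W\<close> and of the Borel law, \<open>T\<close> for the mixture
  \<open>(1 - I) W + I (Z + Wstar)\<close>, and put
  \<open>e n = (n - 1) p n - lam (\<Sum>k\<le>n. b k (n - k) p (n - k))\<close>. As \<open>Wstar\<close> has mass \<open>(1 - lam) n p n\<close> at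
  \<open>n\<close>, the difference of the mass functions of \<open>Wstar\<close> and \<open>T\<close> is \<open>(1 - lam) e\<close>. The bound is therefore
  a stability statement for the equation \<open>e = 0\<close>, which the Borel law satisfies by a form of Abel's
  binomial identity (\<open>borel_mass_recurrence\<close>).

  The equation is solved with generating functions. Let \<open>B\<close>, \<open>P\<close>, \<open>E\<close> be those of \<open>b\<close>, \<open>p\<close>, \<open>e\<close>. The
  recurrence for \<open>b\<close> reads \<open>X B' (1 - lam B) = B\<close>, and the definition of \<open>e\<close> reads
  \<open>E = X P' (1 - lam B) - P\<close>. Dividing, the quotient \<open>R = P / B\<close> satisfies \<open>R' = (E / X^2) D\<close> with
  \<open>D = X^2 B' / B^2 = (X / B) / (1 - lam B)\<close>. Two facts about \<open>D\<close> carry the proof: its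
  coefficients \<open>d\<close> are nonnegative (\<open>stein_gf_nonneg\<close>) and sum to \<open>1 / (1 - lam)\<close> (\<open>stein_gf_sums\<close>).

  Integrating and multiplying by \<open>B\<close> expresses \<open>p\<close> through \<open>e\<close>, up to a multiple of \<open>b\<close> that the total
  mass determines. For a set \<open>A\<close> this gives \<open>P(W \<in> A) - P(Z \<in> A) = (\<Sum>n. e n * h n)\<close>, where
  \<open>h (m + 2) = (\<Sum>i. d i (P(Z + m + i + 1 \<in> A) - P(Z \<in> A)) / (m + i + 1))\<close>
  (\<open>stein_representation\<close>; \<open>e 0 = e 1 = 0\<close>). Hence \<open>h\<close> takes values in an interval of length
  \<open>1 / (1 - lam)\<close>. Since \<open>(1 - lam) e\<close> is a difference of two probability mass functions, its integral
  against \<open>h\<close> is at most that length times the total variation distance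
  (\<open>integral_diff_le_tv_dist\<close>), and the remaining factor \<open>1 - lam\<close> gives the square.
\<close>

section \<open>Abel's identity and the Borel recurrence\<close>

text \<open>
  An \<open>n\<close>-th finite difference kills powers of degree below \<open>n\<close>. In generating functions:
  \<open>(exp X - 1)^n\<close> has no term of degree below \<open>n\<close>.
\<close>

lemma alternating_binomial_power_sum:
  fixes n m :: nat
  assumes "m < n"
  shows "(\<Sum>k\<le>n. real (n choose k) * real k ^ m * (-1) ^ (n - k)) = 0"
proof -
  let ?a = "fps_exp (1::real) + fps_const (-1)"
  have "fps_nth (?a ^ n) m = 0"
    by (rule startsby_zero_power_prefix[rule_format]) (use assms in auto)
  moreover have "?a ^ n = (\<Sum>k\<le>n. fps_const (real (n choose k) * (-1) ^ (n - k)) * fps_exp (real k))"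
    unfolding binomial_ring
    by (intro sum.cong refl)
       (simp add: fps_exp_power_mult fps_const_power fps_of_nat[symmetric] mult_ac
          flip: fps_const_mult del: fps_const_neg)
  ultimately have "(\<Sum>k\<le>n. real (n choose k) * (-1) ^ (n - k) * (real k ^ m / fact m)) = 0"
    by (simp add: fps_sum_nth)
  then have "(\<Sum>k\<le>n. real (n choose k) * real k ^ m * (-1) ^ (n - k)) / fact m = 0"
    by (simp add: sum_divide_distrib mult_ac)
  then show ?thesis by simp
qed

text \<open>
  The case of Abel's binomial identity behind the Borel recurrence. Both sides are polynomials in
  \<open>y\<close>; the derivatives agree by induction, and the values at \<open>0\<close> agree because the left side is then
  an alternating binomial sum of a power of too low degree.
\<close>

lemma abel_sum:
  fixes y :: real
  shows "(\<Sum>k=1..Suc n. real (Suc n choose k) * real k ^ (k - 1) * (y - real k) ^ (Suc n - k))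
    = real (Suc n) * y ^ n"
proof (induction n arbitrary: y)
  case 0
  then show ?case by simp
next
  case (Suc n)
  let ?N = "Suc (Suc n)"
  define F where "F y = (\<Sum>k=1..?N. real (?N choose k) * real k ^ (k - 1) * (y - real k) ^ (?N - k))
      - real ?N * y ^ Suc n" for y :: real
  have F0: "F 0 = 0"
  proof -
    have *: "real (?N choose k) * real k ^ (k - 1) * (0 - real k) ^ (?N - k)
        = real (?N choose k) * real k ^ Suc n * (-1) ^ (?N - k)" if "k \<in> {1..?N}" for k
    proof -
      have "(0 - real k) ^ (?N - k) = (-1) ^ (?N - k) * real k ^ (?N - k)"
        by (simp add: power_mult_distrib[symmetric])
      then have "real (?N choose k) * real k ^ (k - 1) * (0 - real k) ^ (?N - k)
          = real (?N choose k) * (real k ^ (k - 1) * real k ^ (?N - k)) * (-1) ^ (?N - k)"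
        by (simp only: mult_ac)
      also have "real k ^ (k - 1) * real k ^ (?N - k) = real k ^ Suc n"
        using that by (simp flip: power_add)
      finally show ?thesis .
    qed
    have "F 0 = (\<Sum>k=1..?N. real (?N choose k) * real k ^ (k - 1) * (0 - real k) ^ (?N - k))"
      unfolding F_def by simp
    also have "\<dots> = (\<Sum>k=1..?N. real (?N choose k) * real k ^ Suc n * (-1) ^ (?N - k))"
      by (intro sum.cong refl *)
    also have "\<dots> = (\<Sum>k\<le>?N. real (?N choose k) * real k ^ Suc n * (-1) ^ (?N - k))"
      by (rule sum.mono_neutral_left) auto
    finally show ?thesis
      using alternating_binomial_power_sum[of "Suc n" ?N] by simp
  qed
  have "(F has_real_derivative 0) (at y)" for y
  proof -
    have pow: "((\<lambda>y. (y - c) ^ m) has_real_derivative real m * (y - c) ^ (m - 1)) (at y)" for c m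
      by (auto intro!: derivative_eq_intros)
    have pow0: "((\<lambda>y. y ^ Suc n) has_real_derivative real (Suc n) * y ^ n) (at y)"
      using pow[of 0 "Suc n"] by simp
    have "(F has_real_derivative
        (\<Sum>k=1..?N. real (?N choose k) * real k ^ (k - 1) * (real (?N - k) * (y - real k) ^ (?N - k - 1)))
        - real ?N * (real (Suc n) * y ^ n)) (at y)"
      unfolding F_def by (intro DERIV_diff DERIV_sum DERIV_cmult pow pow0)
    moreover have "(\<Sum>k=1..?N. real (?N choose k) * real k ^ (k - 1) * (real (?N - k) * (y - real k) ^ (?N - k - 1)))
        = real ?N * (\<Sum>k=1..Suc n. real (Suc n choose k) * real k ^ (k - 1) * (y - real k) ^ (Suc n - k))"
    proof -
      have "real (?N - k) * real (?N choose k) = real ?N * real (Suc n choose k)" for k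
        using binomial_absorb_comp[of ?N k] by (metis diff_Suc_1 of_nat_mult)
      then have *: "real (?N choose k) * real k ^ (k - 1) * (real (?N - k) * (y - real k) ^ (?N - k - 1))
          = real ?N * (real (Suc n choose k) * real k ^ (k - 1) * (y - real k) ^ (Suc n - k))"
        if "k \<in> {1..Suc n}" for k
        using that by (simp add: mult.left_commute[of _ "real (?N - k)"] mult.commute[of _ "real (?N - k)"]
            flip: mult.assoc del: binomial_Suc_Suc of_nat_Suc of_nat_diff)
      have "(\<Sum>k=1..?N. real (?N choose k) * real k ^ (k - 1) * (real (?N - k) * (y - real k) ^ (?N - k - 1)))
          = (\<Sum>k=1..Suc n. real (?N choose k) * real k ^ (k - 1) * (real (?N - k) * (y - real k) ^ (?N - k - 1)))"
        by (subst sum.cl_ivl_Suc) simp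
      also have "\<dots> = (\<Sum>k=1..Suc n. real ?N * (real (Suc n choose k) * real k ^ (k - 1) * (y - real k) ^ (Suc n - k)))"
        by (intro sum.cong refl *)
      finally show ?thesis
        by (simp only: sum_distrib_left)
    qed
    ultimately show ?thesis using Suc.IH[of y] by simp
  qed
  then have "F y = F 0"
    by (intro DERIV_isconst_all) auto
  then show ?case using F0 by (simp add: F_def)
qed

text \<open>
  Up to the factor \<open>1 - lam\<close>, this says that the size-biased Borel law is the law of the mixture in the
  theorem for \<open>W\<close> itself Borel. The powers of \<open>lam\<close> and the exponentials factor out of the sum, and
  Abel's identity at \<open>y = n\<close>, without its last summand, remains.
\<close>

lemma borel_mass_recurrence:
  assumes "0 < lam"
  shows "(real n - 1) * borel_mass lam n
    = lam * (\<Sum>k\<le>n. real k * borel_mass lam k * borel_mass lam (n - k))"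
proof (cases "n \<le> 1")
  case True
  then show ?thesis by (cases n) (auto simp: borel_mass_def)
next
  case False
  then obtain m where n: "n = Suc m" and m: "1 \<le> m" by (cases n) auto
  let ?c = "exp (- lam * real n) * lam ^ (n - 2) / fact n"
  have summand: "real k * borel_mass lam k * borel_mass lam (n - k)
      = ?c * (real (n choose (n - k)) * real (n - k) ^ (n - k - 1) * real k ^ k)"
    if k: "k \<in> {1..m}" for k
  proof -
    define i where "i = m - k"
    have i: "n - k = Suc i" "n = Suc i + k" using k n by (auto simp: i_def)
    obtain j where j: "k = Suc j" using k by (cases k) auto
    have e: "exp (- lam * real k) * exp (- lam * real (n - k)) = exp (- lam * real n)"
      using i by (simp flip: exp_add add: algebra_simps)
    have l: "lam ^ (k - 1) * lam ^ (n - k - 1) = lam ^ (n - 2)"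
      using i j by (simp flip: power_add add: add.commute)
    have c: "real (n choose (n - k)) = fact n / (fact k * fact (n - k))"
      using k n by (simp add: binomial_fact mult.commute)
    show ?thesis
      using j i(1) unfolding borel_mass_def e[symmetric] l[symmetric] c
      by (simp add: power_mult_distrib divide_simps)
  qed
  have "(\<Sum>k\<le>n. real k * borel_mass lam k * borel_mass lam (n - k))
      = (\<Sum>k=1..m. real k * borel_mass lam k * borel_mass lam (n - k))"
    by (rule sum.mono_neutral_right) (auto simp: n borel_mass_def)
  also have "\<dots> = ?c * (\<Sum>k=1..m. real (n choose (n - k)) * real (n - k) ^ (n - k - 1)
      * real k ^ k)"
    unfolding sum_distrib_left by (intro sum.cong refl summand)
  also have "(\<Sum>k=1..m. real (n choose (n - k)) * real (n - k) ^ (n - k - 1)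
      * real k ^ k)
      = (\<Sum>k=1..m. real (n choose k) * real k ^ (k - 1) * (real n - real k) ^ (n - k))"
    by (rule sum.reindex_bij_witness[of _ "\<lambda>k. n - k" "\<lambda>k. n - k"]) (auto simp: n)
  also have "\<dots> = real n * real n ^ m - real n ^ m"
    using abel_sum[of m "real n"] by (simp add: n)
  finally have "(\<Sum>k\<le>n. real k * borel_mass lam k * borel_mass lam (n - k))
      = ?c * (real n * real n ^ m - real n ^ m)" .
  moreover have "borel_mass lam n = exp (- lam * real n) * (lam ^ m * real n ^ m) / fact n"
    by (simp add: borel_mass_def n power_mult_distrib)
  moreover have "lam ^ m = lam * lam ^ (n - 2)"
    using m by (cases m) (auto simp: n)
  ultimately show ?thesis
    by (simp add: algebra_simps)
qed

section \<open>Convolutions and power series with summable coefficients\<close>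

text \<open>
  Summing \<open>x m * y i * g (m + i)\<close> along the diagonals \<open>m + i = n\<close> or along the rows \<open>m\<close> gives the same
  value: convolution is exchanged for its adjoint, acting on the bounded function \<open>g\<close>.
\<close>

lemma transposed_cauchy_product:
  fixes x y g :: "nat \<Rightarrow> real"
  assumes x: "summable (\<lambda>n. \<bar>x n\<bar>)" and y: "summable (\<lambda>n. \<bar>y n\<bar>)" and g: "\<And>n. \<bar>g n\<bar> \<le> c"
  obtains S where "(\<lambda>n. (\<Sum>i\<le>n. x i * y (n - i)) * g n) sums S"
    and "(\<lambda>m. x m * (\<Sum>i. y i * g (m + i))) sums S"
proof -
  define f where "f = (\<lambda>(m, i). x m * y i * g (m + i))"
  have ax: "(\<lambda>i. norm (x i)) summable_on UNIV" and ay: "(\<lambda>i. norm (y i)) summable_on UNIV"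
    using x y by (auto simp: summable_on_UNIV_nonneg_real_iff)
  have "(\<lambda>p. norm ((\<lambda>(m, i). x m * y i) p)) summable_on UNIV \<times> UNIV"
    using abs_summable_on_product[of UNIV UNIV x y] ax ay
    by (simp flip: abs_summable_equivalent)
  then have "(\<lambda>p. c * norm ((\<lambda>(m, i). x m * y i) p)) summable_on UNIV \<times> UNIV"
    by (intro summable_on_cmult_right)
  then have "(\<lambda>p. norm (f p)) summable_on UNIV \<times> UNIV"
  proof (rule Infinite_Sum.abs_summable_on_comparison_test')
    fix p :: "nat \<times> nat"
    show "norm (f p) \<le> c * norm ((\<lambda>(m, i). x m * y i) p)"
      using mult_left_mono[OF g[of "fst p + snd p"], of "\<bar>x (fst p) * y (snd p)\<bar>"]
      by (simp add: f_def abs_mult case_prod_beta mult_ac)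
  qed
  then obtain S where S: "(f has_sum S) (UNIV \<times> UNIV)"
    using abs_summable_summable summable_on_def by blast
  have "((\<lambda>(n, i). f (i, n - i)) has_sum S) (Sigma UNIV (\<lambda>n. {..n}))"
    by (subst has_sum_reindex_bij_witness[of _ "\<lambda>(m, i). (m + i, m)" "\<lambda>(n, i). (i, n - i)" "UNIV \<times> UNIV" f])
       (use S in auto)
  then have "((\<lambda>n. \<Sum>i\<le>n. f (i, n - i)) has_sum S) UNIV"
    by (rule has_sum_SigmaD) (auto intro: has_sum_finite)
  moreover have "(\<Sum>i\<le>n. f (i, n - i)) = (\<Sum>i\<le>n. x i * y (n - i)) * g n" for n
    by (simp add: f_def sum_distrib_right)
  ultimately have 1: "(\<lambda>n. (\<Sum>i\<le>n. x i * y (n - i)) * g n) sums S"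
    using has_sum_imp_sums by simp
  have "((\<lambda>i. f (m, i)) has_sum (x m * (\<Sum>i. y i * g (m + i)))) UNIV" for m
  proof -
    have "summable (\<lambda>i. norm (y i * g (m + i)))"
    proof (rule summable_comparison_test')
      show "summable (\<lambda>i. \<bar>y i\<bar> * c)" by (intro summable_mult2 y)
      show "norm (norm (y i * g (m + i))) \<le> \<bar>y i\<bar> * c" for i
        using mult_left_mono[OF g[of "m + i"], of "\<bar>y i\<bar>"] by (simp add: abs_mult)
    qed
    then have "((\<lambda>i. y i * g (m + i)) has_sum (\<Sum>i. y i * g (m + i))) UNIV"
      by (rule norm_summable_imp_has_sum) (rule summable_sums[OF summable_norm_cancel], fact)
    then have "((\<lambda>i. x m * (y i * g (m + i))) has_sum (x m * (\<Sum>i. y i * g (m + i)))) UNIV"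
      by (rule has_sum_cmult_right)
    then show ?thesis by (simp add: f_def mult.assoc)
  qed
  then have "((\<lambda>m. x m * (\<Sum>i. y i * g (m + i))) has_sum S) UNIV"
    using S by (intro has_sum_SigmaD[of f UNIV "\<lambda>_. UNIV" S]) auto
  then show ?thesis using that 1 has_sum_imp_sums by blast
qed

lemma fps_mult_nonneg:
  fixes f g :: "real fps"
  assumes "\<And>n. 0 \<le> fps_nth f n" "\<And>n. 0 \<le> fps_nth g n"
  shows "0 \<le> fps_nth (f * g) n"
  unfolding fps_mult_nth by (intro sum_nonneg mult_nonneg_nonneg assms)

text \<open>
  The differential equation is a recursion with nonnegative coefficients for the coefficients of
  \<open>f\<close>.
\<close>

lemma fps_nonneg_if_deriv:
  fixes f c :: "real fps"
  assumes "fps_deriv f = c * f" and c: "\<And>n. 0 \<le> fps_nth c n" and "0 \<le> fps_nth f 0"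
  shows "0 \<le> fps_nth f n"
proof (induction n rule: less_induct)
  case (less n)
  show ?case
  proof (cases n)
    case (Suc m)
    have "real n * fps_nth f n = fps_nth (c * f) m"
      using Suc assms(1) by (metis Suc_eq_plus1 fps_deriv_nth)
    also have "\<dots> \<ge> 0"
      unfolding fps_mult_nth by (intro sum_nonneg mult_nonneg_nonneg c less.IH) (auto simp: Suc)
    finally show ?thesis using Suc by (simp add: zero_le_mult_iff)
  qed (use assms in simp)
qed

text \<open>
  A sign change in the recursion does not matter for absolute values, so a multiple of
  \<open>g\<close> majorizes \<open>f\<close>.
\<close>

lemma fps_abs_le_if_deriv:
  fixes f g c :: "real fps"
  assumes f: "fps_deriv f = - (c * f)" and g: "fps_deriv g = c * g"
    and c: "\<And>n. 0 \<le> fps_nth c n" and 0: "\<bar>fps_nth f 0\<bar> \<le> M * fps_nth g 0"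
  shows "\<bar>fps_nth f n\<bar> \<le> M * fps_nth g n"
proof (induction n rule: less_induct)
  case (less n)
  show ?case
  proof (cases n)
    case (Suc m)
    have "real n * fps_nth f n = - fps_nth (c * f) m"
      using Suc f by (metis Suc_eq_plus1 fps_deriv_nth fps_neg_nth)
    then have "real n * \<bar>fps_nth f n\<bar> = \<bar>fps_nth (c * f) m\<bar>"
      by (metis abs_minus_cancel abs_mult abs_of_nat)
    also have "\<dots> \<le> (\<Sum>i=0..m. fps_nth c i * (M * fps_nth g (m - i)))"
      unfolding fps_mult_nth
      by (intro order_trans[OF sum_abs] sum_mono)
         (auto simp: abs_mult c Suc intro!: mult_left_mono less.IH)
    also have "\<dots> = M * fps_nth (c * g) m"
      unfolding fps_mult_nth sum_distrib_left by (simp add: mult_ac)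
    also have "\<dots> = real n * (M * fps_nth g n)"
      using Suc g by (metis Suc_eq_plus1 fps_deriv_nth mult.left_commute)
    finally show ?thesis using Suc by simp
  qed (use 0 in simp)
qed

lemma fps_mult_sums:
  fixes f g :: "real fps"
  assumes "summable (\<lambda>n. \<bar>fps_nth f n\<bar>)" "summable (\<lambda>n. \<bar>fps_nth g n\<bar>)"
    and "fps_nth f sums a" "fps_nth g sums b"
  shows "fps_nth (f * g) sums (a * b)"
proof -
  have "fps_nth (f * g) = (\<lambda>n. \<Sum>i\<le>n. fps_nth f i * fps_nth g (n - i))"
    by (auto simp: fps_mult_nth atMost_atLeast0)
  then show ?thesis
    using Cauchy_product_sums[of "fps_nth f" "fps_nth g"] assms by (simp add: sums_iff)
qed

lemma fps_mult_abs_summable: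
  fixes f g :: "real fps"
  assumes "summable (\<lambda>n. \<bar>fps_nth f n\<bar>)" "summable (\<lambda>n. \<bar>fps_nth g n\<bar>)"
  shows "summable (\<lambda>n. \<bar>fps_nth (f * g) n\<bar>)"
proof (rule summable_comparison_test')
  show "summable (\<lambda>n. \<Sum>i\<le>n. \<bar>fps_nth f i\<bar> * \<bar>fps_nth g (n - i)\<bar>)"
    using summable_Cauchy_product[of "\<lambda>n. \<bar>fps_nth f n\<bar>" "\<lambda>n. \<bar>fps_nth g n\<bar>"] assms by simp
  show "norm \<bar>fps_nth (f * g) n\<bar> \<le> (\<Sum>i\<le>n. \<bar>fps_nth f i\<bar> * \<bar>fps_nth g (n - i)\<bar>)" for n
    using sum_abs[of "\<lambda>i. fps_nth f i * fps_nth g (n - i)" "{..n}"]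
    by (simp add: fps_mult_nth atMost_atLeast0 abs_mult)
qed

section \<open>Generating functions of the Borel law\<close>

text \<open>
  That the Borel masses sum to one is a hypothesis of the locale; in the theorem it comes from the
  random variable \<open>Z\<close>.
\<close>

locale borel_law =
  fixes lam :: real
  assumes lam_pos: "0 < lam" and lam_less_1: "lam < 1"
    and borel_mass_sums: "borel_mass lam sums 1"
begin

definition gf :: "real fps" where
  "gf = Abs_fps (borel_mass lam)"

definition reduced_gf :: "real fps" where
  "reduced_gf = fps_shift 1 gf"

text \<open>
  This is \<open>(\<Sum>n. lam ^ n * gf ^ n)\<close>, the Green function of a walk with Borel steps that survives
  each step with probability \<open>lam\<close>.
\<close>

definition renewal_gf :: "real fps" where
  "renewal_gf = inverse (1 - fps_const lam * gf)"

text \<open>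
  By the differential equation for the Borel law this is \<open>X^2 B' / B^2\<close>, the kernel that recovers
  \<open>(P / B)'\<close> from the error term. The form below avoids division by \<open>B\<close>, which has no
  constant term.
\<close>

definition stein_gf :: "real fps" where
  "stein_gf = inverse reduced_gf * renewal_gf"

lemma borel_mass_nonneg: "0 \<le> borel_mass lam n"
  using lam_pos by (simp add: borel_mass_def)

lemma gf_nth [simp]: "fps_nth gf n = borel_mass lam n"
  by (simp add: gf_def)

lemma borel_mass_0 [simp]: "borel_mass lam 0 = 0"
  by (simp add: borel_mass_def)

lemma gf_eq: "gf = fps_X * reduced_gf"
  by (rule fps_ext) (auto simp: reduced_gf_def)

lemma reduced_gf_nth_0: "0 < fps_nth reduced_gf 0"
  by (simp add: reduced_gf_def borel_mass_def)

lemma reduced_gf_inverse: "reduced_gf * inverse reduced_gf = 1"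
  using reduced_gf_nth_0 by (intro inverse_mult_eq_1') simp

lemma renewal_gf_inverse: "(1 - fps_const lam * gf) * renewal_gf = 1"
  unfolding renewal_gf_def by (intro inverse_mult_eq_1') simp

lemma gf_ode: "fps_X * fps_deriv gf * (1 - fps_const lam * gf) = gf"
proof (rule fps_ext)
  fix n
  have X: "fps_nth (fps_X * fps_deriv gf) k = real k * borel_mass lam k" for k
    by (cases k) auto
  have "fps_nth (fps_X * fps_deriv gf * (1 - fps_const lam * gf)) n
      = fps_nth (fps_X * fps_deriv gf) n - lam * fps_nth ((fps_X * fps_deriv gf) * gf) n"
    by (simp add: right_diff_distrib mult.left_commute[of _ "fps_const lam"] del: fps_mult_fps_X_deriv_shift)
  also have "\<dots> = real n * borel_mass lam n
      - lam * (\<Sum>k\<le>n. real k * borel_mass lam k * borel_mass lam (n - k))"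
    by (simp only: fps_mult_nth[of "fps_X * fps_deriv gf"] X gf_nth atMost_atLeast0)
  also have "\<dots> = fps_nth gf n"
    using borel_mass_recurrence[OF lam_pos, of n] by (simp add: algebra_simps)
  finally show "fps_nth (fps_X * fps_deriv gf * (1 - fps_const lam * gf)) n = fps_nth gf n" .
qed

lemma gf_ode': "fps_deriv gf * (1 - fps_const lam * gf) = reduced_gf"
proof -
  have "fps_X * (fps_deriv gf * (1 - fps_const lam * gf)) = fps_X * reduced_gf"
    using gf_ode gf_eq by (simp add: mult.assoc)
  then show ?thesis by simp
qed

lemma reduced_gf_deriv: "fps_deriv reduced_gf = fps_const lam * fps_deriv gf * reduced_gf"
proof -
  have "fps_deriv gf = reduced_gf + fps_X * fps_deriv reduced_gf"
    by (subst gf_eq) simp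
  then have "fps_X * fps_deriv reduced_gf = fps_deriv gf - fps_deriv gf * (1 - fps_const lam * gf)"
    unfolding gf_ode' by (simp only: add_diff_cancel_left')
  also have "\<dots> = fps_const lam * fps_deriv gf * gf"
    by (simp add: algebra_simps)
  also have "\<dots> = fps_X * (fps_const lam * fps_deriv gf * reduced_gf)"
    by (subst (2) gf_eq) (simp add: mult_ac)
  finally show ?thesis by simp
qed

lemma renewal_gf_rec: "renewal_gf = 1 + fps_const lam * gf * renewal_gf"
  using renewal_gf_inverse by (simp add: algebra_simps)

lemma renewal_gf_nonneg: "0 \<le> fps_nth renewal_gf n"
proof (induction n rule: less_induct)
  case (less n)
  have "fps_nth renewal_gf n = fps_nth 1 n + lam * fps_nth (gf * renewal_gf) n"
    by (subst renewal_gf_rec) (simp add: mult.assoc)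
  moreover have "0 \<le> fps_nth (gf * renewal_gf) n"
    unfolding fps_mult_nth
  proof (intro sum_nonneg)
    fix i assume "i \<in> {0..n}"
    then show "0 \<le> fps_nth gf i * fps_nth renewal_gf (n - i)"
      using less.IH[of "n - i"] borel_mass_nonneg[of i] by (cases "i = 0") auto
  qed
  ultimately show ?case using lam_pos by simp
qed

lemma borel_mass_abs_summable: "summable (\<lambda>n. \<bar>borel_mass lam n\<bar>)"
  using borel_mass_sums by (simp add: borel_mass_nonneg sums_iff)

text \<open>
  The partial sums \<open>S\<close> satisfy \<open>S = 1 + lam (b * S)\<close> (convolution), and \<open>1 / (1 - lam)\<close> is the fixed
  point of \<open>s \<mapsto> 1 + lam s\<close>. As \<open>b 0 = 0\<close>, only earlier partial sums enter on the right.
\<close>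

lemma renewal_gf_partial_sums: "(\<Sum>i\<le>n. fps_nth renewal_gf i) \<le> 1 / (1 - lam)"
proof -
  let ?one = "Abs_fps (\<lambda>_. 1 :: real)"
  define S where "S = ?one * renewal_gf"
  have S_nth: "fps_nth S n = (\<Sum>i\<le>n. fps_nth renewal_gf i)" for n
    by (simp add: S_def mult.commute[of ?one] fps_mult_nth atMost_atLeast0)
  have S_eq: "S = ?one + fps_const lam * (gf * S)"
    unfolding S_def by (subst renewal_gf_rec) (simp add: algebra_simps)
  have "fps_nth S n \<le> 1 / (1 - lam)"
  proof (induction n rule: less_induct)
    case (less n)
    have "fps_nth (gf * S) n \<le> (\<Sum>i=0..n. borel_mass lam i * (1 / (1 - lam)))"
      unfolding fps_mult_nth
    proof (intro sum_mono)
      fix i assume "i \<in> {0..n}"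
      then show "fps_nth gf i * fps_nth S (n - i) \<le> borel_mass lam i * (1 / (1 - lam))"
        using less.IH[of "n - i"] by (cases "i = 0") (auto intro: mult_left_mono borel_mass_nonneg simp del: times_divide_eq_right)
    qed
    also have "\<dots> = (\<Sum>i\<le>n. borel_mass lam i) * (1 / (1 - lam))"
      by (simp add: sum_distrib_right atMost_atLeast0 sum_divide_distrib)
    also have "\<dots> \<le> 1 * (1 / (1 - lam))"
    proof (rule mult_right_mono)
      show "(\<Sum>i\<le>n. borel_mass lam i) \<le> 1"
        using sum_le_suminf[of "borel_mass lam" "{..n}"] borel_mass_sums borel_mass_nonneg
        by (simp add: sums_iff)
    qed (use lam_less_1 in simp)
    finally have "lam * fps_nth (gf * S) n \<le> lam * (1 / (1 - lam))"
      using lam_pos by (intro mult_left_mono) auto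
    moreover have "fps_nth S n = 1 + lam * fps_nth (gf * S) n"
      by (subst S_eq) simp
    moreover have "1 + lam * (1 / (1 - lam)) = 1 / (1 - lam)"
      using lam_less_1 by (simp add: field_simps)
    ultimately show ?case by linarith
  qed
  then show ?thesis by (simp add: S_nth)
qed

lemma renewal_gf_abs_summable: "summable (\<lambda>n. \<bar>fps_nth renewal_gf n\<bar>)"
proof (rule bounded_imp_summable)
  show "(\<Sum>i\<le>n. \<bar>fps_nth renewal_gf i\<bar>) \<le> 1 / (1 - lam)" for n
    using renewal_gf_partial_sums[of n] by (simp add: renewal_gf_nonneg)
qed simp

lemma inverse_reduced_gf_deriv:
  "fps_deriv (inverse reduced_gf) = - (fps_const lam * fps_deriv gf * inverse reduced_gf)"
proof -
  have "fps_deriv (inverse reduced_gf) = - fps_deriv reduced_gf * (inverse reduced_gf)\<^sup>2"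
    using reduced_gf_nth_0 by (intro fps_inverse_deriv) simp
  also have "\<dots> = - (fps_const lam * fps_deriv gf * inverse reduced_gf) * (reduced_gf * inverse reduced_gf)"
    by (simp add: reduced_gf_deriv power2_eq_square algebra_simps)
  finally show ?thesis by (simp add: reduced_gf_inverse)
qed

lemma scaled_deriv_gf_nonneg: "0 \<le> fps_nth (fps_const lam * fps_deriv gf) n"
  using lam_pos by (simp add: borel_mass_nonneg)

text \<open>
  The coefficients of \<open>X / B\<close> are signed, but \<open>X / B\<close> and \<open>B / X\<close> satisfy the same linear
  differential equation up to the sign, so a multiple of the latter is a
  summable majorant.
\<close>

lemma inverse_reduced_gf_abs_summable: "summable (\<lambda>n. \<bar>fps_nth (inverse reduced_gf) n\<bar>)"
proof (rule summable_comparison_test')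
  define M where "M = \<bar>fps_nth (inverse reduced_gf) 0\<bar> / fps_nth reduced_gf 0"
  have M: "\<bar>fps_nth (inverse reduced_gf) 0\<bar> \<le> M * fps_nth reduced_gf 0"
    using reduced_gf_nth_0 by (simp add: M_def field_simps)
  have "summable (\<lambda>n. borel_mass lam (n + 1))"
    using borel_mass_sums unfolding summable_iff_shift by (simp add: sums_iff)
  moreover have "fps_nth reduced_gf = (\<lambda>n. borel_mass lam (n + 1))"
    by (simp add: reduced_gf_def fun_eq_iff)
  ultimately have "summable (fps_nth reduced_gf)" by simp
  then show "summable (\<lambda>n. M * fps_nth reduced_gf n)"
    by (rule summable_mult)
  show "norm \<bar>fps_nth (inverse reduced_gf) n\<bar> \<le> M * fps_nth reduced_gf n" for n
    using fps_abs_le_if_deriv[OF inverse_reduced_gf_deriv reduced_gf_deriv scaled_deriv_gf_nonneg M, of n]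
    by simp
qed

lemma stein_gf_inverse: "reduced_gf * (1 - fps_const lam * gf) * stein_gf = 1"
proof -
  have "reduced_gf * (1 - fps_const lam * gf) * stein_gf
      = (reduced_gf * inverse reduced_gf) * ((1 - fps_const lam * gf) * renewal_gf)"
    by (simp add: stein_gf_def mult_ac)
  then show ?thesis by (simp add: reduced_gf_inverse renewal_gf_inverse)
qed

text \<open>
  Although \<open>X / B\<close> has negative coefficients, the logarithmic derivative of the product with
  \<open>1 / (1 - lam B)\<close> is \<open>lam B' (1 / (1 - lam B) - 1)\<close>, where the subtraction only removes the constant
  term.
\<close>

lemma stein_gf_nonneg: "0 \<le> fps_nth stein_gf n"
proof (rule fps_nonneg_if_deriv)
  let ?c = "fps_const lam * fps_deriv gf"
  have "fps_deriv renewal_gf = - fps_deriv (1 - fps_const lam * gf) * renewal_gf\<^sup>2"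
    unfolding renewal_gf_def by (intro fps_inverse_deriv) simp
  also have "\<dots> = ?c * renewal_gf * renewal_gf"
    by (simp add: power2_eq_square mult_ac)
  finally have "fps_deriv stein_gf = ?c * (renewal_gf - 1) * stein_gf"
    unfolding stein_gf_def by (simp add: inverse_reduced_gf_deriv algebra_simps)
  also have "renewal_gf - 1 = fps_const lam * gf * renewal_gf"
    using renewal_gf_rec by (metis add_diff_cancel_left')
  finally show "fps_deriv stein_gf = ?c * (fps_const lam * gf * renewal_gf) * stein_gf" .
  show "0 \<le> fps_nth (?c * (fps_const lam * gf * renewal_gf)) n" for n
  proof (rule fps_mult_nonneg[OF scaled_deriv_gf_nonneg fps_mult_nonneg[OF _ renewal_gf_nonneg]])
    show "0 \<le> fps_nth (fps_const lam * gf) n" for n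
      using lam_pos by (simp add: borel_mass_nonneg)
  qed
  show "0 \<le> fps_nth stein_gf 0"
    using reduced_gf_nth_0 by (simp add: stein_gf_def renewal_gf_def)
qed

lemma stein_gf_abs_summable: "summable (\<lambda>n. \<bar>fps_nth stein_gf n\<bar>)"
  unfolding stein_gf_def
  by (intro fps_mult_abs_summable inverse_reduced_gf_abs_summable renewal_gf_abs_summable)

text \<open>
  Evaluate \<open>B (1 - lam B) D = X\<close> at \<open>1\<close>; absolute summability of the three factors allows this.
\<close>

lemma stein_gf_sums: "fps_nth stein_gf sums (1 / (1 - lam))"
proof -
  let ?V = "1 - fps_const lam * gf"
  have "fps_nth 1 = (\<lambda>n. if n = 0 then 1 else 0 :: real)" by auto
  then have one: "fps_nth 1 sums (1::real)"
    using sums_single[of 0 "\<lambda>_. 1::real"] by simp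
  have "fps_nth fps_X = (\<lambda>n. if n = 1 then 1 else 0 :: real)" by auto
  then have X: "fps_nth fps_X sums (1::real)"
    using sums_single[of 1 "\<lambda>_. 1::real"] by simp
  have V_nth: "fps_nth ?V = (\<lambda>n. fps_nth 1 n - lam * borel_mass lam n)" by auto
  have V: "fps_nth ?V sums (1 - lam)"
    unfolding V_nth using sums_diff[OF one sums_mult[OF borel_mass_sums, of lam]] by simp
  have V': "summable (\<lambda>n. \<bar>fps_nth ?V n\<bar>)"
  proof (rule summable_comparison_test')
    show "summable (\<lambda>n. fps_nth 1 n + lam * borel_mass lam n)"
      using one borel_mass_sums by (intro summable_add summable_mult) (auto simp: sums_iff)
    show "norm \<bar>fps_nth ?V n\<bar> \<le> fps_nth 1 n + lam * borel_mass lam n" for n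
      using lam_pos borel_mass_nonneg[of n] unfolding V_nth by (cases n) auto
  qed
  have G: "summable (\<lambda>n. \<bar>fps_nth gf n\<bar>)" using borel_mass_abs_summable by simp
  have "fps_nth gf = borel_mass lam" by auto
  then have G': "fps_nth gf sums 1" using borel_mass_sums by simp
  obtain d where d: "fps_nth stein_gf sums d"
    using summable_sums[OF summable_rabs_cancel[OF stein_gf_abs_summable]] by blast
  have "fps_nth (gf * ?V * stein_gf) sums (1 * (1 - lam) * d)"
    by (intro fps_mult_sums fps_mult_abs_summable G G' V' V d stein_gf_abs_summable)
  moreover have "gf * ?V * stein_gf = fps_X"
  proof -
    have "gf * ?V * stein_gf = fps_X * (reduced_gf * ?V * stein_gf)"
      by (subst gf_eq) (simp only: mult.assoc)
    then show ?thesis by (simp only: stein_gf_inverse mult_1_right)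
  qed
  ultimately have "(1 - lam) * d = 1"
    using X sums_unique2[of "fps_nth fps_X" "1 * (1 - lam) * d" 1] by simp
  then have "d = 1 / (1 - lam)" using lam_less_1 by (simp add: eq_divide_eq mult.commute)
  then show ?thesis using d by simp
qed

text \<open>
  Variation of constants: \<open>B\<close> solves \<open>X Y' (1 - lam B) - Y = 0\<close>, so substituting \<open>P = R B\<close> in the
  left side leaves only the term with \<open>R'\<close>.
\<close>

lemma factor_deriv:
  fixes P :: "real fps"
  assumes "fps_nth P 0 = 0"
  obtains R where "P = R * gf"
    and "fps_deriv R = fps_shift 2 (fps_X * fps_deriv P * (1 - fps_const lam * gf) - P) * stein_gf"
proof
  define R where "R = fps_shift 1 P * inverse reduced_gf"
  have "P = fps_X * fps_shift 1 P"
    by (rule fps_ext) (use assms in auto)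
  also have "\<dots> = (fps_X * fps_shift 1 P) * (reduced_gf * inverse reduced_gf)"
    by (simp add: reduced_gf_inverse)
  also have "\<dots> = R * gf"
    by (subst gf_eq) (simp add: R_def mult_ac)
  finally show P: "P = R * gf" .
  let ?V = "1 - fps_const lam * gf"
  have "fps_X * fps_deriv P * ?V - P
      = fps_X * gf * ?V * fps_deriv R + R * (fps_X * fps_deriv gf * ?V) - R * gf"
    unfolding P by (simp add: algebra_simps)
  also have "\<dots> = fps_X * gf * ?V * fps_deriv R"
    by (simp add: gf_ode)
  also have "\<dots> = (reduced_gf * ?V * fps_deriv R) * fps_X ^ 2"
    unfolding power2_eq_square by (subst gf_eq) (simp only: mult_ac)
  finally have E: "fps_shift 2 (fps_X * fps_deriv P * ?V - P) = reduced_gf * ?V * fps_deriv R"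
    by (simp only: fps_shift_times_fps_X_power')
  have "fps_shift 2 (fps_X * fps_deriv P * ?V - P) * stein_gf
      = (reduced_gf * ?V * stein_gf) * fps_deriv R"
    unfolding E by (simp only: mult_ac)
  then show "fps_deriv R = fps_shift 2 (fps_X * fps_deriv P * ?V - P) * stein_gf"
    by (simp only: stein_gf_inverse mult_1_left)
qed

end

section \<open>Solving the Stein equation\<close>

text \<open>
  In the language of Stein's method, \<open>h\<close> plays the role of the solution of the Stein equation for the
  indicator of \<open>A\<close>. It arises by applying to that indicator the adjoints of the two convolutions that
  lead from \<open>e\<close> to \<open>p\<close>: \<open>p n = (\<Sum>i\<le>n. r i b (n - i))\<close> and
  \<open>(n + 1) r (n + 1) = (\<Sum>i\<le>n. e (i + 2) d (n - i))\<close>.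
\<close>

lemma (in borel_law) stein_representation:
  fixes p e :: "nat \<Rightarrow> real" and A :: "nat set"
  assumes p0: "p 0 = 0" and p: "p sums 1" and p_abs: "summable (\<lambda>n. \<bar>p n\<bar>)"
    and e: "\<And>n. e n = (real n - 1) * p n
      - lam * (\<Sum>k\<le>n. borel_mass lam k * (real (n - k) * p (n - k)))"
    and e_abs: "summable (\<lambda>n. \<bar>e n\<bar>)"
    and pA: "(\<lambda>n. p n * indicator A n) sums pA"
    and bA: "(\<lambda>n. borel_mass lam n * indicator A n) sums bA"
  obtains h where "(\<lambda>n. e n * h n) sums (pA - bA)"
    and "\<And>n. - bA / (1 - lam) \<le> h n" and "\<And>n. h n \<le> (1 - bA) / (1 - lam)"
proof -
  let ?P = "Abs_fps p"
  let ?d = "fps_nth stein_gf"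
  obtain R where R: "?P = R * gf"
    and R': "fps_deriv R = fps_shift 2 (fps_X * fps_deriv ?P * (1 - fps_const lam * gf) - ?P) * stein_gf"
    using factor_deriv[of ?P] p0 by auto
  define r where "r = fps_nth R"
  have X: "fps_nth (fps_X * fps_deriv ?P) n = real n * p n" for n
    by (cases n) auto
  have E: "fps_nth (fps_X * fps_deriv ?P * (1 - fps_const lam * gf) - ?P) n = e n" for n
  proof -
    have "fps_X * fps_deriv ?P * (1 - fps_const lam * gf) - ?P
        = fps_X * fps_deriv ?P - fps_const lam * (gf * (fps_X * fps_deriv ?P)) - ?P"
      by (simp add: algebra_simps)
    then have "fps_nth (fps_X * fps_deriv ?P * (1 - fps_const lam * gf) - ?P) n
        = real n * p n - lam * (\<Sum>k\<le>n. borel_mass lam k * (real (n - k) * p (n - k))) - p n"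
      by (simp only: fps_sub_nth fps_mult_left_const_nth fps_mult_nth[of gf] X gf_nth atMost_atLeast0 fps_nth_Abs_fps)
    then show ?thesis by (simp add: e algebra_simps)
  qed
  have r_Suc: "real (Suc n) * r (Suc n) = (\<Sum>i\<le>n. e (i + 2) * ?d (n - i))" for n
  proof -
    have "real (Suc n) * r (Suc n) = fps_nth (fps_deriv R) n"
      by (simp add: r_def)
    also have "\<dots> = (\<Sum>i\<le>n. e (i + 2) * ?d (n - i))"
      unfolding R' fps_mult_nth fps_shift_nth E by (simp add: atMost_atLeast0)
    finally show ?thesis .
  qed
  have p_conv: "(\<Sum>i\<le>n. r i * borel_mass lam (n - i)) = p n" for n
  proof -
    have "p n = fps_nth (R * gf) n" by (simp flip: R)
    then show ?thesis by (simp add: fps_mult_nth r_def atMost_atLeast0)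
  qed
  have e2_abs: "summable (\<lambda>n. \<bar>e (n + 2)\<bar>)"
    using e_abs summable_iff_shift[of "\<lambda>n. \<bar>e n\<bar>" 2] by simp
  have r_abs: "summable (\<lambda>n. \<bar>r n\<bar>)"
  proof -
    have "summable (\<lambda>n. \<Sum>i\<le>n. \<bar>e (i + 2)\<bar> * \<bar>?d (n - i)\<bar>)"
      using summable_Cauchy_product[of "\<lambda>n. \<bar>e (n + 2)\<bar>" "\<lambda>n. \<bar>?d n\<bar>"] e2_abs stein_gf_abs_summable
      by simp
    then have "summable (\<lambda>n. \<bar>r (Suc n)\<bar>)"
    proof (rule summable_comparison_test')
      fix n
      have "\<bar>r (Suc n)\<bar> \<le> real (Suc n) * \<bar>r (Suc n)\<bar>"
        by (simp add: mult_le_cancel_right1)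
      also have "\<dots> = \<bar>\<Sum>i\<le>n. e (i + 2) * ?d (n - i)\<bar>"
        by (simp only: r_Suc[symmetric] abs_mult abs_of_nat)
      also have "\<dots> \<le> (\<Sum>i\<le>n. \<bar>e (i + 2)\<bar> * \<bar>?d (n - i)\<bar>)"
        unfolding abs_mult[symmetric] by (rule sum_abs)
      finally show "norm \<bar>r (Suc n)\<bar> \<le> (\<Sum>i\<le>n. \<bar>e (i + 2)\<bar> * \<bar>?d (n - i)\<bar>)" by simp
    qed
    then show ?thesis using summable_Suc_iff by blast
  qed
  \<comment> \<open>The probability that a Borel variable shifted by \<open>m\<close> lies in \<open>A\<close>.\<close>
  define \<beta> where "\<beta> m = (\<Sum>i. borel_mass lam i * indicator A (m + i))" for m
  have \<beta>_summable: "summable (\<lambda>i. borel_mass lam i * indicator A (m + i))" for m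
    by (rule summable_comparison_test'[OF borel_mass_abs_summable]) (auto simp: indicator_def)
  have \<beta>_ge: "0 \<le> \<beta> m" for m
    unfolding \<beta>_def by (intro suminf_nonneg \<beta>_summable mult_nonneg_nonneg borel_mass_nonneg) auto
  have \<beta>_le: "\<beta> m \<le> 1" for m
  proof -
    have "\<beta> m \<le> (\<Sum>i. borel_mass lam i)"
      unfolding \<beta>_def using borel_mass_sums
      by (intro suminf_le \<beta>_summable) (auto simp: indicator_def borel_mass_nonneg sums_iff)
    then show ?thesis using borel_mass_sums by (simp add: sums_iff)
  qed
  have \<beta>_0: "\<beta> 0 = bA" using bA by (simp add: \<beta>_def sums_iff)
  have "(\<lambda>m. r m * \<beta> m) sums pA"
  proof -
    obtain S where "(\<lambda>n. (\<Sum>i\<le>n. r i * borel_mass lam (n - i)) * indicator A n) sums S"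
      and "(\<lambda>m. r m * \<beta> m) sums S"
      using transposed_cauchy_product[OF r_abs borel_mass_abs_summable, of "indicator A" 1]
      unfolding \<beta>_def by (auto simp: indicator_def)
    then show ?thesis using pA by (simp add: p_conv sums_iff)
  qed
  moreover have "r sums 1"
  proof -
    obtain S where "(\<lambda>n. (\<Sum>i\<le>n. r i * borel_mass lam (n - i)) * 1) sums S"
      and "(\<lambda>m. r m * (\<Sum>i. borel_mass lam i * 1)) sums S"
      using transposed_cauchy_product[OF r_abs borel_mass_abs_summable, of "\<lambda>_. 1" 1] by auto
    then show ?thesis using p borel_mass_sums by (simp add: p_conv sums_iff)
  qed
  ultimately have "(\<lambda>m. r m * \<beta> m - r m * bA) sums (pA - 1 * bA)"
    by (intro sums_diff sums_mult2)
  then have "(\<lambda>m. r m * (\<beta> m - bA)) sums (pA - bA)"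
    by (simp add: algebra_simps)
  \<comment> \<open>The constant of integration \<open>r 0\<close> disappears because \<open>\<beta> 0 = bA\<close>.\<close>
  then have *: "(\<lambda>m. r (Suc m) * (\<beta> (Suc m) - bA)) sums (pA - bA)"
    using \<beta>_0 by (subst sums_Suc_iff) simp
  define G where "G m = (\<beta> (Suc m) - bA) / real (Suc m)" for m
  have bA_01: "0 \<le> bA" "bA \<le> 1" using \<beta>_ge[of 0] \<beta>_le[of 0] \<beta>_0 by auto
  have G_ge: "- bA \<le> G m" and G_le: "G m \<le> 1 - bA" for m
  proof -
    have "- bA * real (Suc m) \<le> - bA * 1"
      using bA_01 by (intro mult_left_mono_neg) auto
    then show "- bA \<le> G m"
      using \<beta>_ge[of "Suc m"] unfolding G_def by (subst pos_le_divide_eq) auto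
    have "(1 - bA) * 1 \<le> (1 - bA) * real (Suc m)"
      using bA_01 by (intro mult_left_mono) auto
    then show "G m \<le> 1 - bA"
      using \<beta>_le[of "Suc m"] unfolding G_def by (subst pos_divide_le_eq) auto
  qed
  have G_abs: "\<bar>G m\<bar> \<le> 1" for m
    using G_ge[of m] G_le[of m] bA_01 by linarith
  define H where "H m = (\<Sum>i. ?d i * G (m + i))" for m
  have "(\<lambda>m. e (m + 2) * H m) sums (pA - bA)"
  proof -
    obtain S where 1: "(\<lambda>n. (\<Sum>i\<le>n. e (i + 2) * ?d (n - i)) * G n) sums S"
      and 2: "(\<lambda>m. e (m + 2) * H m) sums S"
      using transposed_cauchy_product[OF e2_abs stein_gf_abs_summable, of G 1] G_abs
      unfolding H_def by auto
    have "(\<Sum>i\<le>n. e (i + 2) * ?d (n - i)) * G n = r (Suc n) * (\<beta> (Suc n) - bA)" for n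
      unfolding r_Suc[symmetric] by (simp add: G_def del: of_nat_Suc)
    then show ?thesis using 1 2 * sums_unique2 by fastforce
  qed
  \<comment> \<open>Truncated subtraction gives \<open>h\<close> arbitrary values at 0 and 1, where \<open>e\<close> vanishes.\<close>
  moreover have "e 0 = 0" "e 1 = 0" using p0 by (simp_all add: e)
  ultimately have "(\<lambda>n. e n * H (n - 2)) sums (pA - bA)"
    using sums_iff_shift[of "\<lambda>n. e n * H (n - 2)" 2 "pA - bA"]
    by (simp add: numeral_2_eq_2)
  moreover have "- bA / (1 - lam) \<le> H m" "H m \<le> (1 - bA) / (1 - lam)" for m
  proof -
    have d: "summable ?d" "suminf ?d = 1 / (1 - lam)"
      using stein_gf_sums by (auto simp: sums_iff)
    have dG: "summable (\<lambda>i. ?d i * G (m + i))"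
    proof (rule summable_comparison_test'[OF d(1)])
      show "norm (?d i * G (m + i)) \<le> ?d i" for i
        using mult_left_mono[OF G_abs[of "m + i"] stein_gf_nonneg[of i]]
        by (simp add: abs_mult stein_gf_nonneg)
    qed
    have "(\<Sum>i. ?d i * - bA) \<le> H m" unfolding H_def
      by (intro suminf_le dG summable_mult2 d mult_left_mono G_ge stein_gf_nonneg)
    then show "- bA / (1 - lam) \<le> H m"
      unfolding suminf_mult2[OF d(1), symmetric] d(2) by simp
    have "H m \<le> (\<Sum>i. ?d i * (1 - bA))" unfolding H_def
      by (intro suminf_le dG summable_mult2 d mult_left_mono G_le stein_gf_nonneg)
    then show "H m \<le> (1 - bA) / (1 - lam)"
      unfolding suminf_mult2[OF d(1), symmetric] d(2) by simp
  qed
  ultimately show ?thesis using that[of "\<lambda>n. H (n - 2)"] by blast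
qed

section \<open>Total variation distance on the natural numbers\<close>

lemma measure_sums_singletons:
  fixes M :: "nat measure"
  assumes "finite_measure M" "sets M = UNIV"
  shows "(\<lambda>n. measure M {n} * indicator A n) sums measure M A"
proof -
  have "(\<lambda>n. measure M (A \<inter> {n})) sums measure M (\<Union>n. A \<inter> {n})"
    using assms by (intro finite_measure.finite_measure_UNION) (auto simp: disjoint_family_on_def)
  moreover have "(\<Union>n. A \<inter> {n}) = A" by auto
  moreover have "measure M (A \<inter> {n}) = measure M {n} * indicator A n" for n
    by (auto simp: indicator_def)
  ultimately show ?thesis by simp
qed

lemma abs_measure_diff_le_tv_dist:
  assumes "prob_space \<mu>" "prob_space \<nu>" "A \<in> sets \<mu>"
  shows "\<bar>measure \<mu> A - measure \<nu> A\<bar> \<le> tv_dist \<mu> \<nu>"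
  unfolding tv_dist_def
proof (rule cSUP_upper[OF assms(3)], rule bdd_aboveI2)
  fix B
  show "\<bar>measure \<mu> B - measure \<nu> B\<bar> \<le> 1"
    using prob_space.prob_le_1[OF assms(1), of B] prob_space.prob_le_1[OF assms(2), of B]
    by (simp add: abs_le_iff) (smt (verit) measure_nonneg)
qed

text \<open>
  The difference of the two mass functions sums to \<open>0\<close>, so \<open>h\<close> may be shifted to take values between
  \<open>0\<close> and \<open>hi - lo\<close>. The sum is then largest when \<open>h\<close> is maximal on the set where the difference is
  nonnegative and minimal elsewhere, and smallest in the opposite case.
\<close>

lemma integral_diff_le_tv_dist:
  fixes \<mu> \<nu> :: "nat measure"
  assumes \<mu>: "prob_space \<mu>" "sets \<mu> = UNIV" and \<nu>: "prob_space \<nu>" "sets \<nu> = UNIV"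
    and s: "(\<lambda>n. (measure \<mu> {n} - measure \<nu> {n}) * h n) sums s"
    and h: "\<And>n. lo \<le> h n" "\<And>n. h n \<le> hi"
  shows "\<bar>s\<bar> \<le> (hi - lo) * tv_dist \<mu> \<nu>"
proof -
  define d where "d n = measure \<mu> {n} - measure \<nu> {n}" for n
  interpret \<mu>: prob_space \<mu> by fact
  interpret \<nu>: prob_space \<nu> by fact
  have sums: "(\<lambda>n. d n * indicator A n) sums (measure \<mu> A - measure \<nu> A)" for A
    using sums_diff[OF measure_sums_singletons[OF \<mu>.finite_measure_axioms \<mu>(2), of A] measure_sums_singletons[OF \<nu>.finite_measure_axioms \<nu>(2), of A]]
    by (simp add: d_def algebra_simps)
  have "space \<mu> = UNIV" "space \<nu> = UNIV"
    using \<mu>(2) \<nu>(2) sets.sets_into_space[of UNIV \<mu>] sets.sets_into_space[of UNIV \<nu>] by auto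
  then have d0: "d sums 0"
    using sums[of UNIV] \<mu>.prob_space \<nu>.prob_space by simp
  \<comment> \<open>The summand for the extremal \<open>h\<close>, equal to \<open>hi\<close> on \<open>A\<close> and to \<open>lo\<close> elsewhere.\<close>
  let ?f = "\<lambda>A n. lo * d n + (hi - lo) * (d n * indicator A n)"
  have f: "?f A sums ((hi - lo) * (measure \<mu> A - measure \<nu> A))" for A
    using sums_add[OF sums_mult[OF d0, of lo] sums_mult[OF sums, of "hi - lo" A]] by simp
  have "lo \<le> hi" using h[of 0] by linarith
  have "s \<le> (hi - lo) * (measure \<mu> {n. 0 \<le> d n} - measure \<nu> {n. 0 \<le> d n})"
  proof (rule sums_le[OF _ s f])
    fix n
    show "(measure \<mu> {n} - measure \<nu> {n}) * h n \<le> ?f {n. 0 \<le> d n} n"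
    proof (cases "0 \<le> d n")
      case True
      then show ?thesis using mult_left_mono[OF h(2)[of n], of "d n"]
        by (simp add: algebra_simps flip: d_def)
    next
      case False
      then show ?thesis using mult_left_mono_neg[OF h(1)[of n], of "d n"]
        by (simp add: algebra_simps flip: d_def)
    qed
  qed
  also have "\<dots> \<le> (hi - lo) * tv_dist \<mu> \<nu>"
    using abs_measure_diff_le_tv_dist[OF \<mu>(1) \<nu>(1), of "{n. 0 \<le> d n}"] \<mu>(2) \<open>lo \<le> hi\<close>
    by (intro mult_left_mono) auto
  finally have upper: "s \<le> (hi - lo) * tv_dist \<mu> \<nu>" .
  have "(hi - lo) * - tv_dist \<mu> \<nu> \<le> (hi - lo) * (measure \<mu> {n. d n < 0} - measure \<nu> {n. d n < 0})"
    using abs_measure_diff_le_tv_dist[OF \<mu>(1) \<nu>(1), of "{n. d n < 0}"] \<mu>(2) \<open>lo \<le> hi\<close>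
    by (intro mult_left_mono) auto
  also have "\<dots> \<le> s"
  proof (rule sums_le[OF _ f s])
    fix n
    show "?f {n. d n < 0} n \<le> (measure \<mu> {n} - measure \<nu> {n}) * h n"
    proof (cases "0 \<le> d n")
      case True
      then show ?thesis using mult_left_mono[OF h(1)[of n], of "d n"]
        by (simp add: algebra_simps flip: d_def)
    next
      case False
      then show ?thesis using mult_left_mono_neg[OF h(2)[of n], of "d n"]
        by (simp add: algebra_simps flip: d_def)
    qed
  qed
  finally show ?thesis using upper by simp
qed

lemma measure_density_count_space:
  assumes "0 \<le> f j"
  shows "measure (density (count_space UNIV) (\<lambda>j. ennreal (f j))) {j} = f j"
proof -
  have "emeasure (density (count_space UNIV) (\<lambda>j. ennreal (f j))) {j} = ennreal (f j)"
    by (subst emeasure_density) (auto simp: nn_integral_count_space_indicator[symmetric] one_ennreal_def[symmetric])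
  then show ?thesis using assms by (simp add: measure_def)
qed

section \<open>The bound for the size-bias mixture\<close>

lemma (in prob_space) indep_vars_4D:
  fixes X0 X1 X2 X3 :: "'a \<Rightarrow> 'b"
  assumes indep: "indep_vars (\<lambda>_. count_space UNIV) (\<lambda>i. [X0, X1, X2, X3] ! i) {..<4::nat}"
  shows "prob {\<omega> \<in> space M. X0 \<omega> \<in> A0 \<and> X1 \<omega> \<in> A1 \<and> X2 \<omega> \<in> A2 \<and> X3 \<omega> \<in> A3}
    = prob {\<omega> \<in> space M. X0 \<omega> \<in> A0} * prob {\<omega> \<in> space M. X1 \<omega> \<in> A1}
      * prob {\<omega> \<in> space M. X2 \<omega> \<in> A2} * prob {\<omega> \<in> space M. X3 \<omega> \<in> A3}"
proof -
  have 4: "{..<4::nat} = {0, 1, 2, 3}" by auto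
  have "{\<omega> \<in> space M. X0 \<omega> \<in> A0 \<and> X1 \<omega> \<in> A1 \<and> X2 \<omega> \<in> A2 \<and> X3 \<omega> \<in> A3}
      = (\<Inter>i\<in>{..<4}. ([X0, X1, X2, X3] ! i) -` ([A0, A1, A2, A3] ! i) \<inter> space M)"
    unfolding 4 by (auto simp: numeral_2_eq_2 numeral_3_eq_3)
  moreover have "prob (\<Inter>i\<in>{..<4}. ([X0, X1, X2, X3] ! i) -` ([A0, A1, A2, A3] ! i) \<inter> space M)
      = (\<Prod>i\<in>{..<4}. prob (([X0, X1, X2, X3] ! i) -` ([A0, A1, A2, A3] ! i) \<inter> space M))"
    by (intro indep_varsD[OF indep]) (auto simp: lessThan_empty_iff)
  moreover have "X -` A \<inter> space M = {\<omega> \<in> space M. X \<omega> \<in> A}" for X :: "'a \<Rightarrow> 'b" and A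
    by auto
  ultimately show ?thesis
    unfolding 4 by (simp add: numeral_2_eq_2 numeral_3_eq_3 mult.assoc)
qed

theorem theorem4:
  fixes M :: "'a measure" and W Wstar I Z :: "'a \<Rightarrow> nat" and lam :: real
  assumes "prob_space M"
    and "0 < lam" and "lam < 1"
    and "prob_space.indep_vars M (\<lambda>_. count_space UNIV) (\<lambda>i. [W, Wstar, I, Z] ! i) {..<4::nat}"
    and "\<And>\<omega>. \<omega> \<in> space M \<Longrightarrow> 1 \<le> W \<omega>"
    and "integrable M (\<lambda>\<omega>. real (W \<omega>))"
    and "(\<integral>\<omega>. real (W \<omega>) \<partial>M) = 1 / (1 - lam)"
    and "law M Wstar = size_biased (law M W)"
    and "\<And>\<omega>. \<omega> \<in> space M \<Longrightarrow> I \<omega> \<in> {0, 1}"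
    and "measure M {\<omega> \<in> space M. I \<omega> = 1} = lam"
    and "law M Z = borel_dist lam"
  shows "tv_dist (law M W) (borel_dist lam)
    \<le> 1 / (1 - lam)\<^sup>2 *
        tv_dist (law M Wstar) (law M (\<lambda>\<omega>. (1 - I \<omega>) * W \<omega> + I \<omega> * (Z \<omega> + Wstar \<omega>)))"
proof -
  interpret prob_space M by fact
  define T where "T \<omega> = (1 - I \<omega>) * W \<omega> + I \<omega> * (Z \<omega> + Wstar \<omega>)" for \<omega>
  have rv: "[W, Wstar, I, Z] ! i \<in> measurable M (count_space UNIV)" if "i < 4" for i :: nat
    using assms(4) that by (auto simp: indep_vars_def)
  have [measurable]: "W \<in> measurable M (count_space UNIV)"
      "Wstar \<in> measurable M (count_space UNIV)"
      "I \<in> measurable M (count_space UNIV)"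
      "Z \<in> measurable M (count_space UNIV)"
    using rv[of 0] rv[of 1] rv[of 2] rv[of 3] by (simp_all add: numeral_2_eq_2 numeral_3_eq_3)
  have [measurable]: "T \<in> measurable M (count_space UNIV)"
    unfolding T_def by measurable
  define p where "p n = prob {\<omega> \<in> space M. W \<omega> \<in> {n}}" for n
  define t where "t n = prob {\<omega> \<in> space M. T \<omega> \<in> {n}}" for n
  have law_singleton: "measure (law M X) {n} = prob {\<omega> \<in> space M. X \<omega> \<in> {n}}"
    if "X \<in> measurable M (count_space UNIV)" for X :: "'a \<Rightarrow> nat" and n
    using that by (subst measure_distr) (auto intro: arg_cong[where f = prob])
  have law_prob: "prob_space (law M X)" if "X \<in> measurable M (count_space UNIV)" for X :: "'a \<Rightarrow> nat"
    using that by (rule prob_space_distr)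
  have law_sums: "(\<lambda>n. prob {\<omega> \<in> space M. X \<omega> \<in> {n}} * indicator A n) sums measure (law M X) A"
    if "X \<in> measurable M (count_space UNIV)" for X :: "'a \<Rightarrow> nat" and A
    using measure_sums_singletons[of "law M X" A] prob_space.finite_measure[OF law_prob[OF that]]
    by (simp add: law_singleton[OF that])
  have law_sums_1: "(\<lambda>n. prob {\<omega> \<in> space M. X \<omega> \<in> {n}}) sums 1"
    if "X \<in> measurable M (count_space UNIV)" for X :: "'a \<Rightarrow> nat"
    using law_sums[OF that, of UNIV] prob_space.prob_space[OF law_prob[OF that]] by simp
  have Z_mass: "prob {\<omega> \<in> space M. Z \<omega> \<in> {n}} = borel_mass lam n" for n
  proof -
    have "measure (borel_dist lam) {n} = borel_mass lam n"
      unfolding borel_dist_def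
      by (rule measure_density_count_space) (use assms(2) in \<open>simp add: borel_mass_def\<close>)
    then show ?thesis using law_singleton[of Z n] assms(11) by simp
  qed
  interpret borel_law lam
    using law_sums_1[of Z, unfolded Z_mass] assms(2,3) by unfold_locales simp_all
  have p_nonneg: "0 \<le> p n" for n by (simp add: p_def)
  have p0: "p 0 = 0"
  proof -
    have "{\<omega> \<in> space M. W \<omega> \<in> {0}} = {}" using assms(5) by fastforce
    then show ?thesis by (simp only: p_def measure_empty)
  qed
  have p: "p sums 1" using law_sums_1[of W] by (simp add: p_def[abs_def])
  have Wstar_mass: "prob {\<omega> \<in> space M. Wstar \<omega> \<in> {n}} = (1 - lam) * (real n * p n)" for n
  proof -
    have "(\<integral>x. real x \<partial>law M W) = 1 / (1 - lam)"
      using assms(7) by (subst integral_distr) auto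
    moreover have "measure (law M W) {j} = p j" for j
      by (simp add: law_singleton p_def)
    ultimately have "size_biased (law M W)
        = density (count_space UNIV) (\<lambda>j. ennreal ((1 - lam) * (real j * p j)))"
      by (simp add: size_biased_def mult.commute)
    then have "measure (law M Wstar) {n} = (1 - lam) * (real n * p n)"
      using assms(3,8) by (simp add: measure_density_count_space p_def)
    then show ?thesis by (simp add: law_singleton)
  qed
  have t: "t n = (1 - lam) * p n
      + lam * (\<Sum>k\<le>n. borel_mass lam k * ((1 - lam) * (real (n - k) * p (n - k))))" for n
  proof -
    \<comment> \<open>Split according to \<open>I\<close>, and for \<open>I = 1\<close> according to the value of \<open>Z\<close>.\<close>
    let ?E = "{\<omega> \<in> space M. W \<omega> \<in> {n} \<and> Wstar \<omega> \<in> UNIV \<and> I \<omega> \<in> {0} \<and> Z \<omega> \<in> UNIV}"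
    let ?F = "\<lambda>k. {\<omega> \<in> space M. W \<omega> \<in> UNIV \<and> Wstar \<omega> \<in> {n - k} \<and> I \<omega> \<in> {1} \<and> Z \<omega> \<in> {k}}"
    have I1: "prob {\<omega> \<in> space M. I \<omega> \<in> {1}} = lam" using assms(10) by simp
    have I0: "prob {\<omega> \<in> space M. I \<omega> \<in> {0}} = 1 - lam"
    proof -
      have "{\<omega> \<in> space M. I \<omega> \<in> {0}} = space M - {\<omega> \<in> space M. I \<omega> \<in> {1}}"
        using assms(9) by auto
      then show ?thesis using I1 by (simp add: prob_compl)
    qed
    have "{\<omega> \<in> space M. T \<omega> \<in> {n}} = ?E \<union> (\<Union>k\<in>{..n}. ?F k)"
    proof (rule set_eqI)
      fix \<omega>
      show "\<omega> \<in> {\<omega> \<in> space M. T \<omega> \<in> {n}} \<longleftrightarrow> \<omega> \<in> ?E \<union> (\<Union>k\<in>{..n}. ?F k)"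
      proof (cases "\<omega> \<in> space M")
        case True
        consider "I \<omega> = 0" | "I \<omega> = 1" using assms(9)[OF True] by auto
        then show ?thesis using True by cases (auto simp: T_def)
      qed simp
    qed
    then have "t n = prob ?E + prob (\<Union>k\<in>{..n}. ?F k)"
      unfolding t_def by (subst finite_measure_Union[symmetric]) auto
    also have "prob (\<Union>k\<in>{..n}. ?F k) = (\<Sum>k\<le>n. prob (?F k))"
      by (intro finite_measure_finite_Union) (auto simp: disjoint_family_on_def)
    also have "prob ?E = (1 - lam) * p n"
      unfolding indep_vars_4D[OF assms(4)] I0 by (simp add: prob_space p_def)
    also have "(\<Sum>k\<le>n. prob (?F k))
        = lam * (\<Sum>k\<le>n. borel_mass lam k * ((1 - lam) * (real (n - k) * p (n - k))))"
      unfolding indep_vars_4D[OF assms(4)] I1 Wstar_mass Z_mass sum_distrib_left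
      by (simp add: prob_space mult_ac)
    finally show ?thesis .
  qed
  define e where "e n = (real n - 1) * p n
      - lam * (\<Sum>k\<le>n. borel_mass lam k * (real (n - k) * p (n - k)))" for n
  have e: "measure (law M Wstar) {n} - measure (law M T) {n} = (1 - lam) * e n" for n
  proof -
    define c where "c = (\<Sum>k\<le>n. borel_mass lam k * (real (n - k) * p (n - k)))"
    have "(\<Sum>k\<le>n. borel_mass lam k * ((1 - lam) * (real (n - k) * p (n - k)))) = (1 - lam) * c"
      unfolding c_def sum_distrib_left by (simp add: mult_ac)
    then have "t n = (1 - lam) * p n + lam * ((1 - lam) * c)" by (simp only: t)
    moreover have "measure (law M T) {n} = t n" by (simp add: law_singleton t_def)
    moreover have "measure (law M Wstar) {n} = (1 - lam) * (real n * p n)"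
      using Wstar_mass[of n] by (simp add: law_singleton)
    moreover have "e n = (real n - 1) * p n - lam * c" by (simp only: e_def c_def)
    ultimately show ?thesis by algebra
  qed
  have p_abs: "summable (\<lambda>n. \<bar>p n\<bar>)"
    using p by (simp add: sums_iff p_nonneg)
  have e_abs: "summable (\<lambda>n. \<bar>e n\<bar>)"
  proof (rule summable_comparison_test')
    show "summable (\<lambda>n. (prob {\<omega> \<in> space M. Wstar \<omega> \<in> {n}} + t n) / (1 - lam))"
      using law_sums_1[of Wstar] law_sums_1[of T]
      by (intro summable_divide summable_add) (auto simp: t_def[abs_def] sums_iff)
    show "norm \<bar>e n\<bar> \<le> (prob {\<omega> \<in> space M. Wstar \<omega> \<in> {n}} + t n) / (1 - lam)" for n
    proof -
      have "e n = (prob {\<omega> \<in> space M. Wstar \<omega> \<in> {n}} - t n) / (1 - lam)"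
        using e[of n] assms(3) by (simp add: law_singleton t_def field_simps)
      moreover have "\<bar>prob {\<omega> \<in> space M. Wstar \<omega> \<in> {n}} - t n\<bar>
          \<le> prob {\<omega> \<in> space M. Wstar \<omega> \<in> {n}} + t n"
        unfolding t_def abs_le_iff by simp
      ultimately show ?thesis using assms(3) by (simp add: divide_right_mono)
    qed
  qed
  let ?tv = "tv_dist (law M Wstar) (law M T)"
  have "\<bar>measure (law M W) A - measure (borel_dist lam) A\<bar> \<le> 1 / (1 - lam)\<^sup>2 * ?tv" for A
  proof -
    let ?b = "measure (borel_dist lam) A"
    have bA: "(\<lambda>n. borel_mass lam n * indicator A n) sums ?b"
      using law_sums[of Z A] by (simp only: Z_mass assms(11)) measurable
    have pA: "(\<lambda>n. p n * indicator A n) sums measure (law M W) A"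
      using law_sums[of W A] by (simp add: p_def)
    obtain h where h: "(\<lambda>n. e n * h n) sums (measure (law M W) A - ?b)"
      "\<And>n. - ?b / (1 - lam) \<le> h n" "\<And>n. h n \<le> (1 - ?b) / (1 - lam)"
      using stein_representation[OF p0 p p_abs e_def e_abs pA bA] by blast
    have "(\<lambda>n. (measure (law M Wstar) {n} - measure (law M T) {n}) * h n)
        sums ((1 - lam) * (measure (law M W) A - ?b))"
      unfolding e using sums_mult[OF h(1), of "1 - lam"] by (simp add: mult.assoc)
    then have "\<bar>(1 - lam) * (measure (law M W) A - ?b)\<bar>
        \<le> ((1 - ?b) / (1 - lam) - (- ?b / (1 - lam))) * ?tv"
      using h(2,3) by (intro integral_diff_le_tv_dist law_prob) auto
    moreover have "(1 - ?b) / (1 - lam) - (- ?b / (1 - lam)) = 1 / (1 - lam)"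
      by (simp add: diff_divide_distrib)
    ultimately have "(1 - lam) * \<bar>measure (law M W) A - ?b\<bar> \<le> 1 / (1 - lam) * ?tv"
      using assms(3) by (simp add: abs_mult)
    then have "\<bar>measure (law M W) A - ?b\<bar> \<le> 1 / (1 - lam) * ?tv / (1 - lam)"
      using assms(3) by (subst pos_le_divide_eq) (auto simp: mult.commute)
    then show ?thesis
      by (simp add: power2_eq_square)
  qed
  then have "tv_dist (law M W) (borel_dist lam) \<le> 1 / (1 - lam)\<^sup>2 * ?tv"
    unfolding tv_dist_def[of "law M W"] by (intro cSUP_least) auto
  then show ?thesis by (simp add: T_def[abs_def])
qed

end
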